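(* Let $N\ge 2$, let $\mathcal{H}_1,\dots,\mathcal{H}_N$ be finite-dimensional complex Hilbert spaces, and let $|\psi\rangle,|\phi\rangle\in\mathcal{H}_1\otimes\cdots\otimes\mathcal{H}_N$ be unit vectors with $\langle\psi|\phi\rangle=0$. Then $|\psi\rangle$ and $|\phi\rangle$ can be perfectly distinguished by local operations and classical communication among $N$ parties, the $r$-th of whom holds the system $\mathcal{H}_r$, given a single copy of the state. That is, there is an LOCC protocol whose final output is "$\psi$" with probability $1$ when the shared system is in the state $|\psi\rangle$, and "$\phi$" with probability $1$ when the shared system is in the state $|\phi\rangle$.
   Context: An LOCC (local operations and classical communication) protocol for $N$ parties sharing $\mathcal{H}_1\otimes\cdots\otimes\mathcal{H}_N$ consists of finitely many rounds. In each round one party $r$ performs a quantum operation with finitely many classical outcomes on their own subsystem only; this may include adjoining a local ancilla in a known state, applying a local unitary, and performing a local projective measurement. Equivalently, party $r$ applies a measurement given by Kraus operators $K_1,\dots,K_s$ on their own (possibly changing, finite-dimensional) space with $\sum_a K_a^\dagger K_a=I$; when the current shared normalized state is $|\xi\rangle$, outcome $a$ occurs with probability $\|(I\otimes K_a\otimes I)|\xi\rangle\|^2$ and the state becomes the normalization of $(I\otimes K_a\otimes I)|\xi\rangle$. The outcome is announced to all parties. The choice of acting party and of measurement in each round may depend on all previously announced outcomes, and on the descriptions of $|\psi\rangle$ and $|\phi\rangle$, which are known to all parties. The final output of the protocol is a function of the sequence of announced outcomes. *)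

theory Defs
  imports Complex_Main "HOL-Library.FuncSet" "Jordan_Normal_Form.Schur_Decomposition"
begin

text \<open>The parties are \<open>0, \<dots>, N - 1\<close> and party \<open>r\<close> holds \<open>\<complex>\<^bsup>d r\<^esup>\<close>. A vector of the tensor product of
  these spaces is given by its coordinates in the product basis, which is indexed by the tuples
  \<open>i\<close> with \<open>i r < d r\<close>. Coordinates outside the index set are 0, so that equal vectors are equal
  functions.\<close>

type_synonym tensor = "(nat \<Rightarrow> nat) \<Rightarrow> complex"

definition tensor_indices :: "nat \<Rightarrow> (nat \<Rightarrow> nat) \<Rightarrow> (nat \<Rightarrow> nat) set" where
  "tensor_indices N d = (\<Pi>\<^sub>E r\<in>{..<N}. {..<d r})"

definition tensor_space :: "nat \<Rightarrow> (nat \<Rightarrow> nat) \<Rightarrow> tensor set" where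
  "tensor_space N d = {\<xi>. \<forall>i. i \<notin> tensor_indices N d \<longrightarrow> \<xi> i = 0}"

definition tensor_inner :: "nat \<Rightarrow> (nat \<Rightarrow> nat) \<Rightarrow> tensor \<Rightarrow> tensor \<Rightarrow> complex" where
  "tensor_inner N d \<xi> \<eta> = (\<Sum>i\<in>tensor_indices N d. cnj (\<xi> i) * \<eta> i)"

definition tensor_norm :: "nat \<Rightarrow> (nat \<Rightarrow> nat) \<Rightarrow> tensor \<Rightarrow> real" where
  "tensor_norm N d \<xi> = sqrt (Re (tensor_inner N d \<xi> \<xi>))"

definition normalize_tensor :: "nat \<Rightarrow> (nat \<Rightarrow> nat) \<Rightarrow> tensor \<Rightarrow> tensor" where
  "normalize_tensor N d \<xi> = (\<lambda>i. \<xi> i / of_real (tensor_norm N d \<xi>))"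

text \<open>The operator \<open>I \<otimes> K \<otimes> I\<close>, with \<open>K\<close> an \<open>m \<times> d r\<close> matrix acting on factor \<open>r\<close>; its values lie
  in the tensor space of shape \<open>d(r := m)\<close>.\<close>

definition apply_local ::
  "nat \<Rightarrow> (nat \<Rightarrow> nat) \<Rightarrow> nat \<Rightarrow> complex mat \<Rightarrow> tensor \<Rightarrow> tensor" where
  "apply_local N d r K \<xi> = (\<lambda>i.
     if i \<in> tensor_indices N (d(r := dim_row K))
     then (\<Sum>j<d r. K $$ (i r, j) * \<xi> (i(r := j))) else 0)"

text \<open>An LOCC protocol is a decision tree, whose nodes correspond to the histories of announced
  outcomes. In \<open>Round r m bs\<close>, party \<open>r\<close> performs a measurement whose Kraus operators map their
  current space to \<open>\<complex>\<^bsup>m\<^esup>\<close>; each outcome is a pair in \<open>bs\<close> of its Kraus operator and the protocol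
  with which the parties continue after it is announced.\<close>

datatype 'a locc = Output 'a | Round nat nat "(complex mat \<times> 'a locc) list"

definition kraus_measurement :: "nat \<Rightarrow> nat \<Rightarrow> complex mat list \<Rightarrow> bool" where
  "kraus_measurement n m Ks \<longleftrightarrow>
     set Ks \<subseteq> carrier_mat m n \<and>
     foldr (+) (map (\<lambda>K. mat_adjoint K * K) Ks) (0\<^sub>m n n) = 1\<^sub>m n"

fun valid_locc :: "nat \<Rightarrow> (nat \<Rightarrow> nat) \<Rightarrow> 'a locc \<Rightarrow> bool" where
  "valid_locc N d (Output v) \<longleftrightarrow> True"
| "valid_locc N d (Round r m bs) \<longleftrightarrow>
     r < N \<and> kraus_measurement (d r) m (map fst bs) \<and>
     (\<forall>(K, P)\<in>set bs. valid_locc N (d(r := m)) P)"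

text \<open>The probability that the final output is \<open>v\<close> when the shared normalized state is \<open>\<xi>\<close>.
  An outcome of probability 0 contributes 0 (its post-measurement state is the zero vector by the
  convention \<open>x / 0 = 0\<close>).\<close>

fun output_prob :: "nat \<Rightarrow> (nat \<Rightarrow> nat) \<Rightarrow> 'a locc \<Rightarrow> tensor \<Rightarrow> 'a \<Rightarrow> real" where
  "output_prob N d (Output w) \<xi> v = (if w = v then 1 else 0)"
| "output_prob N d (Round r m bs) \<xi> v =
     (\<Sum>(K, P)\<leftarrow>bs.
        (tensor_norm N (d(r := m)) (apply_local N d r K \<xi>))\<^sup>2 *
        output_prob N (d(r := m)) P
          (normalize_tensor N (d(r := m)) (apply_local N d r K \<xi>)) v)"

datatype verdict = Psi | Phi

end

theory Submission
  imports Defs "HOL-Library.Multiset"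
begin

text \<open>The parties measure one after another with rank-one Kraus operators \<open>\<langle>x|\<close>, which collapse their
  space to \<open>\<complex>\<close>. If \<open>M\<close> is the matrix of inner products \<open>\<langle>\<psi>\<^sub>i|\<phi>\<^sub>j\<rangle>\<close> of the components of the two
  states along the basis of the measuring party, then orthogonality says that \<open>M\<close> has trace 0, and
  outcome \<open>x\<close> leaves two vectors with inner product \<open>q x = \<Sum>\<^sub>i\<^sub>j cnj (x i) * x j * M i j\<close>. So it suffices
  to find a tight frame (\<open>\<Sum>\<^sub>x |x\<rangle>\<langle>x| = I\<close>) on which \<open>q\<close> vanishes. Starting from the standard basis,
  where \<open>q\<close> sums to 0, one rotates pairs of frame vectors at which \<open>Re q\<close> has opposite signs until
  \<open>Re q = 0\<close> on the whole frame, and then does the same with \<open>Im q\<close>, choosing the relative phase of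
  the pair such that \<open>Re q\<close> stays 0. After all parties have measured, the remaining states are
  orthogonal scalars, hence one of them is 0 and the outcomes reveal the state.\<close>

section \<open>Isotropic frames for sesquilinear forms of trace zero\<close>

definition sesq :: "nat \<Rightarrow> (nat \<Rightarrow> nat \<Rightarrow> complex) \<Rightarrow> (nat \<Rightarrow> complex) \<Rightarrow> (nat \<Rightarrow> complex) \<Rightarrow> complex" where
  "sesq n M x y = (\<Sum>i<n. \<Sum>j<n. cnj (x i) * y j * M i j)"

text \<open>The matrix of the sum of K\<dagger>K over the rows K in \<open>X\<close>, not the matrix
  of inner products between members of \<open>X\<close>. A multiset allows repeated vectors.\<close>

definition gram :: "(nat \<Rightarrow> complex) multiset \<Rightarrow> nat \<Rightarrow> nat \<Rightarrow> complex" where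
  "gram X i j = (\<Sum>x\<in>#X. cnj (x i) * x j)"

lemma gram_add: "gram (X + Y) i j = gram X i j + gram Y i j"
  by (simp add: gram_def)

lemma sesq_combination:
  "sesq n M (\<lambda>i. a * x i + b * y i) (\<lambda>i. a * x i + b * y i) =
     cnj a * a * sesq n M x x + cnj b * b * sesq n M y y +
     (cnj a * b * sesq n M x y + cnj b * a * sesq n M y x)"
  unfolding sesq_def sum_distrib_left sum.distrib[symmetric]
  by (intro sum.cong refl) (simp add: algebra_simps)

text \<open>The sum of the form over a frame depends on the frame only through \<open>gram\<close>,
  so exchanging vectors without changing \<open>gram\<close> preserves it.\<close>

lemma sum_sesq_eq_gram:
  "(\<Sum>x\<in>#X. sesq n M x x) = (\<Sum>i<n. \<Sum>j<n. gram X i j * M i j)"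
  by (induction X) (simp_all add: gram_def sesq_def distrib_right sum.distrib)

text \<open>Rotating in the plane of \<open>x\<close> and \<open>c * y\<close> leads continuously
  from \<open>x\<close> at angle 0 to \<open>c * y\<close> at angle \<open>pi / 2\<close>, so the
  real part vanishes in between. Rotations are unitary and keep \<open>gram\<close>. The factor
  \<open>w\<close> selects the real part (1) or minus the imaginary part (\<open>\<i>\<close>); the
  phase \<open>c\<close> stays free to control the cross term \<open>C\<close>.\<close>

lemma rotate_pair:
  assumes "Re (w * sesq n M x x) > 0" "Re (w * sesq n M y y) < 0" "cmod c = 1"
  defines "C \<equiv> c * sesq n M x y + cnj c * sesq n M y x"
  obtains x' y' a b where
    "Re (w * sesq n M x' x') = 0"
    "gram {#x', y'#} = gram {#x, y#}"
    "sesq n M x' x' = of_real (a\<^sup>2) * sesq n M x x + of_real (b\<^sup>2) * sesq n M y y + of_real (a * b) * C"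
    "sesq n M y' y' = of_real (b\<^sup>2) * sesq n M x x + of_real (a\<^sup>2) * sesq n M y y - of_real (a * b) * C"
proof -
  have cc: "cnj c * c = 1" "c * cnj c = 1"
    using assms(3) complex_norm_square[of c] by (simp_all add: mult.commute)
  define X where "X = (\<lambda>t i. of_real (cos t) * x i + (of_real (sin t) * c) * y i)"
  define Y where "Y = (\<lambda>t i. of_real (- sin t) * x i + (of_real (cos t) * c) * y i)"
  have abs_c: "cnj (of_real p * c) * (of_real p * c) = of_real (p\<^sup>2)" for p
  proof -
    have "cnj (of_real p * c) * (of_real p * c) = of_real p * of_real p * (cnj c * c)"
      by (simp add: algebra_simps)
    then show ?thesis by (simp add: cc power2_eq_square)
  qed
  have qX: "sesq n M (X t) (X t) = of_real ((cos t)\<^sup>2) * sesq n M x x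
      + of_real ((sin t)\<^sup>2) * sesq n M y y + of_real (cos t * sin t) * C" for t
    unfolding X_def sesq_combination C_def abs_c
    by (simp add: power2_eq_square algebra_simps)
  have qY: "sesq n M (Y t) (Y t) = of_real ((sin t)\<^sup>2) * sesq n M x x
      + of_real ((cos t)\<^sup>2) * sesq n M y y - of_real (cos t * sin t) * C" for t
    unfolding Y_def sesq_combination C_def abs_c
    by (simp add: power2_eq_square algebra_simps)
  define f where "f = (\<lambda>t. Re (w * sesq n M (X t) (X t)))"
  have "\<exists>t\<ge>0. t \<le> pi / 2 \<and> f t = 0"
  proof (rule IVT2')
    show "f (pi / 2) \<le> 0" "0 \<le> f 0"
      using assms(1,2) by (simp_all add: f_def qX)
    show "continuous_on {0..pi / 2} f"
      unfolding f_def qX by (intro continuous_intros)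
  qed simp
  then obtain t where t: "f t = 0" by blast
  have sc: "of_real (cos t) * of_real (cos t) + of_real (sin t) * of_real (sin t) = (1 :: complex)"
    by (metis of_real_1 of_real_add of_real_mult power2_eq_square sin_cos_squared_add2)
  have "cnj (X t i) * X t j + cnj (Y t i) * Y t j = cnj (x i) * x j + cnj (y i) * y j" for i j
  proof -
    have "cnj (X t i) * X t j + cnj (Y t i) * Y t j =
      (of_real (cos t) * of_real (cos t) + of_real (sin t) * of_real (sin t)) *
      (cnj (x i) * x j + cnj c * c * (cnj (y i) * y j))"
      by (simp add: X_def Y_def algebra_simps)
    then show ?thesis using sc cc by simp
  qed
  then have "gram {#X t, Y t#} = gram {#x, y#}"
    by (intro ext) (simp add: gram_def)
  then show ?thesis
    using that[of "X t" "Y t", OF _ _ qX qY] t by (simp add: f_def)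
qed

lemma sum_mset_zero_signs:
  fixes f :: "'a \<Rightarrow> real"
  assumes "(\<Sum>x\<in>#X. f x) = 0" "\<not> (\<forall>x\<in>#X. f x = 0)"
  obtains x y Z where "X = {#x, y#} + Z" "f x > 0" "f y < 0"
proof -
  have *: "\<exists>x\<in>#X. g x > 0" if "(\<Sum>x\<in>#X. g x) = 0" "\<not> (\<forall>x\<in>#X. g x = 0)" for g :: "'a \<Rightarrow> real"
  proof (rule ccontr)
    assume "\<not> ?thesis"
    then have "\<forall>x\<in>#X. g x \<le> 0" by force
    then have "(\<forall>x\<in>#X. g x = 0) \<and> (\<Sum>x\<in>#X. g x) \<le> 0 \<or> (\<Sum>x\<in>#X. g x) < 0"
      by (induction X) (auto simp: add_neg_nonpos add_nonpos_neg less_eq_real_def)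
    with that show False by auto
  qed
  obtain x where x: "x \<in># X" "f x > 0" using *[of f] assms by blast
  have "(\<Sum>x\<in>#X. - f x) = - (\<Sum>x\<in>#X. f x)" by (induction X) auto
  with *[of "\<lambda>x. - f x"] assms obtain y where y: "y \<in># X" "f y < 0" by auto
  obtain Z where "X = add_mset x Z" using x by (meson multi_member_split)
  \<comment> \<open>Opposite signs of \<open>f\<close> make \<open>x\<close> and \<open>y\<close>
    distinct, so \<open>y\<close> survives the removal of \<open>x\<close>.\<close>
  moreover then obtain Z' where "Z = add_mset y Z'" using x y by (auto dest!: multi_member_split)
  ultimately show ?thesis using that x y by simp
qed

text \<open>Each exchange yields a vector \<open>x'\<close> with value 0, which is set aside. The
  remaining multiset is smaller by one and its values still sum to 0, so induction on the size
  applies. \<open>P\<close> is a property that the exchanges preserve.\<close>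

lemma frame_zero_part:
  assumes pair: "\<And>x y. P x \<Longrightarrow> P y \<Longrightarrow> Re (w * sesq n M x x) > 0 \<Longrightarrow> Re (w * sesq n M y y) < 0 \<Longrightarrow>
    \<exists>x' y'. P x' \<and> P y' \<and> Re (w * sesq n M x' x') = 0 \<and> gram {#x', y'#} = gram {#x, y#}"
  assumes "\<forall>x\<in>#X. P x" "Re (w * (\<Sum>x\<in>#X. sesq n M x x)) = 0"
  shows "\<exists>X'. (\<forall>x\<in>#X'. P x \<and> Re (w * sesq n M x x) = 0) \<and> gram X' = gram X"
  using assms(2,3)
proof (induction "size X" arbitrary: X rule: less_induct)
  case less
  let ?q = "\<lambda>x. Re (w * sesq n M x x)"
  have sum_q: "Re (w * (\<Sum>x\<in>#Y. sesq n M x x)) = (\<Sum>x\<in>#Y. ?q x)" for Y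
    by (induction Y) (auto simp: algebra_simps)
  show ?case
  proof (cases "\<forall>x\<in>#X. ?q x = 0")
    case True
    with less.prems show ?thesis by blast
  next
    case False
    obtain x y Z where X: "X = {#x, y#} + Z" and q: "?q x > 0" "?q y < 0"
      using sum_mset_zero_signs[OF less.prems(2)[unfolded sum_q] False] by blast
    obtain x' y' where P: "P x'" "P y'" and z: "?q x' = 0"
      and g: "gram {#x', y'#} = gram {#x, y#}"
      using pair[of x y] q less.prems(1) X by auto
    have gX: "gram ({#x', y'#} + Z) = gram X"
      unfolding X by (intro ext) (simp only: gram_add g)
    then have "(\<Sum>x\<in>#{#x', y'#} + Z. sesq n M x x) = (\<Sum>x\<in>#X. sesq n M x x)"
      by (simp only: sum_sesq_eq_gram)
    then have e: "sesq n M x' x' + (\<Sum>x\<in>#add_mset y' Z. sesq n M x x) = (\<Sum>x\<in>#X. sesq n M x x)"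
      by simp
    have "?q x' + Re (w * (\<Sum>x\<in>#add_mset y' Z. sesq n M x x)) = 0"
      using less.prems(2) unfolding e[symmetric] by (simp only: distrib_left plus_complex.sel)
    then have "Re (w * (\<Sum>x\<in>#add_mset y' Z. sesq n M x x)) = 0"
      using z by linarith
    moreover have "\<forall>v\<in>#add_mset y' Z. P v" using less.prems(1) P X by auto
    ultimately obtain X' where X': "\<forall>x\<in>#X'. P x \<and> ?q x = 0" "gram X' = gram (add_mset y' Z)"
      using less.hyps[of "add_mset y' Z"] X by auto
    have "gram (add_mset x' X') = gram ({#x', y'#} + Z)"
      using X'(2) by (intro ext) (simp add: gram_def fun_eq_iff)
    then show ?thesis using X'(1) P z gX
      by (intro exI[of _ "add_mset x' X'"]) auto
  qed
qed

text \<open>Supplies the relative phase for which \<open>rotate_pair\<close> preserves a vanishing real part.\<close>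

lemma ex_unit_cross_imaginary:
  fixes u v :: complex
  shows "\<exists>c. cmod c = 1 \<and> Re (c * u + cnj c * v) = 0"
proof (cases "u + cnj v = 0")
  case True
  then have "Re u + Re v = 0" by (simp add: complex_eq_iff)
  then show ?thesis by (intro exI[of _ 1]) simp
next
  case False
  define z where "z = u + cnj v"
  \<comment> \<open>\<open>Re (cnj c * v) = Re (c * cnj v)\<close>, so the expression equals
    \<open>Re (c * z)\<close>; this phase rotates \<open>z\<close> onto the imaginary axis.\<close>
  define c where "c = \<i> * cnj z / of_real (cmod z)"
  have "z \<noteq> 0" using False by (simp add: z_def)
  then have "cmod c = 1" by (simp add: c_def norm_mult norm_divide)
  moreover have "Re (c * u + cnj c * v) = Re (c * z)" by (simp add: z_def algebra_simps)
  moreover have "c * z = \<i> * of_real (cmod z)"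
    using complex_norm_square[of z] \<open>z \<noteq> 0\<close>
    by (simp add: c_def field_simps power2_eq_square)
  ultimately show ?thesis by (intro exI[of _ c]) simp
qed

lemma ex_isotropic_frame:
  assumes tr: "(\<Sum>i<n. M i i) = 0"
  shows "\<exists>X. (\<forall>x\<in>#X. sesq n M x x = 0) \<and>
    (\<forall>i<n. \<forall>j<n. gram X i j = (if i = j then 1 else 0))"
proof -
  \<comment> \<open>The standard basis: its \<open>gram\<close> is the identity on indices below
    \<open>n\<close>, which turns the sum of the form into the trace of \<open>M\<close>.\<close>
  define E where "E = image_mset (\<lambda>a i. if i = a then 1 else 0 :: complex) (mset_set {..<n})"
  have gE: "gram E i j = (if i = j then 1 else 0)" if "i < n" "j < n" for i j
  proof -
    have "gram E i j = (\<Sum>a<n. (if i = a then 1 else 0) * (if j = a then 1 else 0))"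
      unfolding gram_def E_def
      by (simp add: image_mset.compositionality o_def sum_unfold_sum_mset if_distrib cong: if_cong)
    also have "\<dots> = (\<Sum>a<n. if i = a then (if j = i then 1 else 0) else 0)"
      by (intro sum.cong) auto
    finally show ?thesis using that by simp
  qed
  have sum0: "(\<Sum>x\<in>#X. sesq n M x x) = 0" if "gram X = gram E" for X
  proof -
    have "(\<Sum>x\<in>#X. sesq n M x x) = (\<Sum>i<n. \<Sum>j<n. if i = j then M i j else 0)"
      unfolding sum_sesq_eq_gram that by (intro sum.cong refl) (simp add: gE)
    then show ?thesis using tr by simp
  qed
  have "\<exists>X. (\<forall>x\<in>#X. True \<and> Re (1 * sesq n M x x) = 0) \<and> gram X = gram E"
  proof (rule frame_zero_part)
    fix x y :: "nat \<Rightarrow> complex"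
    assume "Re (1 * sesq n M x x) > 0" "Re (1 * sesq n M y y) < 0"
    from rotate_pair[OF this, of 1]
    show "\<exists>x' y'. True \<and> True \<and> Re (1 * sesq n M x' x') = 0 \<and> gram {#x', y'#} = gram {#x, y#}"
      by (metis norm_one)
  qed (auto simp: sum0)
  then obtain X where X: "\<forall>x\<in>#X. Re (sesq n M x x) = 0" "gram X = gram E" by auto
  \<comment> \<open>Second pass: \<open>Re (\<i> * q) = - Im q\<close>, and the preserved property
    is the vanishing real part from the first pass.\<close>
  have "\<exists>Y. (\<forall>x\<in>#Y. Re (sesq n M x x) = 0 \<and> Re (\<i> * sesq n M x x) = 0) \<and> gram Y = gram X"
  proof (rule frame_zero_part)
    fix x y :: "nat \<Rightarrow> complex"
    assume re: "Re (sesq n M x x) = 0" "Re (sesq n M y y) = 0"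
    assume im: "Re (\<i> * sesq n M x x) > 0" "Re (\<i> * sesq n M y y) < 0"
    obtain c where c: "cmod c = 1" "Re (c * sesq n M x y + cnj c * sesq n M y x) = 0"
      using ex_unit_cross_imaginary by blast
    obtain x' y' a b where
      "Re (\<i> * sesq n M x' x') = 0" "gram {#x', y'#} = gram {#x, y#}"
      "sesq n M x' x' = of_real (a\<^sup>2) * sesq n M x x + of_real (b\<^sup>2) * sesq n M y y
         + of_real (a * b) * (c * sesq n M x y + cnj c * sesq n M y x)"
      "sesq n M y' y' = of_real (b\<^sup>2) * sesq n M x x + of_real (a\<^sup>2) * sesq n M y y
         - of_real (a * b) * (c * sesq n M x y + cnj c * sesq n M y x)"
      using rotate_pair[OF im c(1)] by metis
    \<comment> \<open>Both new values are real combinations of three numbers with real part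
      0.\<close>
    moreover from this re c(2) have "Re (sesq n M x' x') = 0" "Re (sesq n M y' y') = 0"
      by (simp_all only: plus_complex.sel minus_complex.sel Re_complex_of_real Im_complex_of_real
          times_complex.sel)
    ultimately show "\<exists>x' y'. Re (sesq n M x' x') = 0 \<and> Re (sesq n M y' y') = 0 \<and>
        Re (\<i> * sesq n M x' x') = 0 \<and> gram {#x', y'#} = gram {#x, y#}"
      by blast
  qed (use X in \<open>auto simp: sum0\<close>)
  then obtain Y where "\<forall>x\<in>#Y. Re (sesq n M x x) = 0 \<and> Re (\<i> * sesq n M x x) = 0" "gram Y = gram X"
    by blast
  then show ?thesis using X gE by (intro exI[of _ Y]) (auto simp: complex_eq_iff)
qed

section \<open>Collapsing one tensor factor\<close>

text \<open>The inner products of the components of \<open>\<xi>\<close> and \<open>\<eta>\<close>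
  along the basis of party \<open>r\<close>. The entry of \<open>t\<close> at \<open>r\<close> is
  only a placeholder, since the collapsed factor is kept as a space of dimension 1.\<close>

definition partial_inner ::
  "nat \<Rightarrow> (nat \<Rightarrow> nat) \<Rightarrow> nat \<Rightarrow> tensor \<Rightarrow> tensor \<Rightarrow> nat \<Rightarrow> nat \<Rightarrow> complex" where
  "partial_inner N d r \<xi> \<eta> i j =
     (\<Sum>t\<in>tensor_indices N (d(r := 1)). cnj (\<xi> (t(r := i))) * \<eta> (t(r := j)))"

text \<open>The entries are not conjugated, which matches the position of \<open>cnj\<close> in
  \<open>sesq\<close> and \<open>gram\<close>.\<close>

definition row_mat :: "nat \<Rightarrow> (nat \<Rightarrow> complex) \<Rightarrow> complex mat" where
  "row_mat n x = mat 1 n (\<lambda>(_, j). x j)"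

lemma collapsed_index_eq_0:
  assumes "r < N" "t \<in> tensor_indices N (d(r := 1))"
  shows "t r = 0"
  using PiE_mem[OF assms(2)[unfolded tensor_indices_def], of r] assms(1) by simp

text \<open>A tuple splits into its entry at \<open>r\<close> and the tuple with that entry reset to
  0. Orthogonality thereby becomes a trace condition.\<close>

lemma tensor_inner_eq_partial_trace:
  assumes "r < N"
  shows "tensor_inner N d \<xi> \<eta> = (\<Sum>i<d r. partial_inner N d r \<xi> \<eta> i i)"
proof -
  have up: "t(r := i) \<in> tensor_indices N d"
    if "t \<in> tensor_indices N (d(r := 1))" "i < d r" for t i
    using that assms
    by (auto simp: tensor_indices_def PiE_iff extensional_def) (metis lessThan_iff)
  have down: "t(r := 0) \<in> tensor_indices N (d(r := 1))" "t r < d r"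
    if "t \<in> tensor_indices N d" for t
    using that assms by (auto simp: tensor_indices_def PiE_iff extensional_def)
  have idem: "t(r := 0) = t" if "t \<in> tensor_indices N (d(r := 1))" for t
    using collapsed_index_eq_0[OF assms that] by (rule fun_upd_idem)
  have "tensor_inner N d \<xi> \<eta> =
    (\<Sum>(i, t)\<in>{..<d r} \<times> tensor_indices N (d(r := 1)). cnj (\<xi> (t(r := i))) * \<eta> (t(r := i)))"
    unfolding tensor_inner_def
    by (rule sum.reindex_bij_witness[of _ "\<lambda>(i, t). t(r := i)" "\<lambda>t. (t r, t(r := 0))"])
      (use up down idem in auto)
  then show ?thesis
    by (simp add: partial_inner_def sum.cartesian_product)
qed

text \<open>Expanding both row sums and moving the sum over \<open>t\<close> inside produces the
  form; hence isotropic rows preserve orthogonality.\<close>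

lemma tensor_inner_apply_row:
  assumes "r < N"
  shows "tensor_inner N (d(r := 1)) (apply_local N d r (row_mat (d r) x) \<xi>)
      (apply_local N d r (row_mat (d r) x) \<eta>) = sesq (d r) (partial_inner N d r \<xi> \<eta>) x x"
proof -
  have "apply_local N d r (row_mat (d r) x) \<zeta> t = (\<Sum>j<d r. x j * \<zeta> (t(r := j)))"
    if "t \<in> tensor_indices N (d(r := 1))" for t \<zeta>
  proof -
    have "t r = 0" using collapsed_index_eq_0[OF assms that] .
    then show ?thesis using that by (simp add: apply_local_def row_mat_def)
  qed
  then have "tensor_inner N (d(r := 1)) (apply_local N d r (row_mat (d r) x) \<xi>)
      (apply_local N d r (row_mat (d r) x) \<eta>) =
    (\<Sum>t\<in>tensor_indices N (d(r := 1)).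
       (\<Sum>i<d r. cnj (x i) * cnj (\<xi> (t(r := i)))) * (\<Sum>j<d r. x j * \<eta> (t(r := j))))"
    by (simp add: tensor_inner_def)
  also have "\<dots> = (\<Sum>t\<in>tensor_indices N (d(r := 1)). \<Sum>i<d r. \<Sum>j<d r.
       cnj (x i) * x j * (cnj (\<xi> (t(r := i))) * \<eta> (t(r := j))))"
    unfolding sum_product by (intro sum.cong refl) (simp only: mult_ac)
  also have "\<dots> = (\<Sum>i<d r. \<Sum>t\<in>tensor_indices N (d(r := 1)). \<Sum>j<d r.
       cnj (x i) * x j * (cnj (\<xi> (t(r := i))) * \<eta> (t(r := j))))"
    by (rule sum.swap)
  also have "\<dots> = (\<Sum>i<d r. \<Sum>j<d r. \<Sum>t\<in>tensor_indices N (d(r := 1)).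
       cnj (x i) * x j * (cnj (\<xi> (t(r := i))) * \<eta> (t(r := j))))"
    by (intro sum.cong refl sum.swap)
  finally show ?thesis
    by (simp add: sesq_def partial_inner_def sum_distrib_left)
qed

lemma kraus_measurement_rows:
  assumes "\<forall>i<n. \<forall>j<n. gram (mset xs) i j = (if i = j then 1 else 0)"
  shows "kraus_measurement n 1 (map (row_mat n) xs)"
proof -
  have adj: "mat_adjoint (row_mat n x) * row_mat n x = mat n n (\<lambda>(i, j). cnj (x i) * x j)" for x
    by (rule eq_matI)
      (auto simp: mat_adjoint_def row_mat_def mat_of_rows_def scalar_prod_def)
  have "foldr (+) (map (\<lambda>K. mat_adjoint K * K) (map (row_mat n) xs)) (0\<^sub>m n n) =
      mat n n (\<lambda>(i, j). gram (mset xs) i j)"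
    by (induction xs) (auto simp: adj gram_def)
  also have "\<dots> = 1\<^sub>m n" using assms by (intro eq_matI) auto
  finally show ?thesis by (auto simp: kraus_measurement_def row_mat_def)
qed

section \<open>Norms and outcome probabilities\<close>

lemma tensor_norm_square:
  "(tensor_norm N d \<xi>)\<^sup>2 = Re (tensor_inner N d \<xi> \<xi>)"
  "complex_of_real ((tensor_norm N d \<xi>)\<^sup>2) = tensor_inner N d \<xi> \<xi>"
proof -
  have "tensor_inner N d \<xi> \<xi> = of_real (\<Sum>i\<in>tensor_indices N d. (cmod (\<xi> i))\<^sup>2)"
    unfolding tensor_inner_def of_real_sum complex_norm_square by (simp only: mult.commute)
  moreover have "(\<Sum>i\<in>tensor_indices N d. (cmod (\<xi> i))\<^sup>2) \<ge> 0" by (intro sum_nonneg) simp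
  ultimately show "(tensor_norm N d \<xi>)\<^sup>2 = Re (tensor_inner N d \<xi> \<xi>)"
    "complex_of_real ((tensor_norm N d \<xi>)\<^sup>2) = tensor_inner N d \<xi> \<xi>"
    by (simp_all add: tensor_norm_def)
qed

lemma tensor_inner_normalize:
  "tensor_inner N d (normalize_tensor N d \<xi>) (normalize_tensor N d \<eta>) =
     tensor_inner N d \<xi> \<eta> / of_real (tensor_norm N d \<xi> * tensor_norm N d \<eta>)"
  by (simp add: tensor_inner_def normalize_tensor_def sum_divide_distrib)

lemma tensor_norm_normalize:
  assumes "tensor_norm N d \<xi> \<noteq> 0"
  shows "tensor_norm N d (normalize_tensor N d \<xi>) = 1"
proof -
  have "tensor_inner N d (normalize_tensor N d \<xi>) (normalize_tensor N d \<xi>) = 1"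
    unfolding tensor_inner_normalize unfolding tensor_norm_square(2)[symmetric]
    using assms by (simp add: power2_eq_square)
  then show ?thesis by (simp add: tensor_norm_def)
qed

text \<open>Conservation of probability: an identity \<open>gram\<close> reduces the summed form to
  the trace of \<open>partial_inner N d r \<xi> \<xi>\<close>.\<close>

lemma sum_norm_square_rows:
  assumes "r < N" "\<forall>i<d r. \<forall>j<d r. gram (mset xs) i j = (if i = j then 1 else 0)"
  shows "(\<Sum>x\<leftarrow>xs. (tensor_norm N (d(r := 1)) (apply_local N d r (row_mat (d r) x) \<xi>))\<^sup>2) =
    (tensor_norm N d \<xi>)\<^sup>2"
proof -
  let ?M = "partial_inner N d r \<xi> \<xi>"
  have "(\<Sum>x\<leftarrow>xs. (tensor_norm N (d(r := 1)) (apply_local N d r (row_mat (d r) x) \<xi>))\<^sup>2) =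
      (\<Sum>x\<leftarrow>xs. Re (sesq (d r) ?M x x))"
    unfolding tensor_norm_square(1) tensor_inner_apply_row[OF assms(1)] ..
  also have "\<dots> = Re (\<Sum>x\<in>#mset xs. sesq (d r) ?M x x)"
    by (induction xs) auto
  also have "\<dots> = Re (\<Sum>i<d r. \<Sum>j<d r. if i = j then ?M i j else 0)"
    unfolding sum_sesq_eq_gram
    by (intro arg_cong[of _ _ Re] sum.cong refl) (use assms(2) in auto)
  also have "\<dots> = (tensor_norm N d \<xi>)\<^sup>2"
    by (simp add: tensor_norm_square(1) tensor_inner_eq_partial_trace[OF assms(1)])
  finally show ?thesis .
qed

text \<open>Outcomes of probability 0 have weight 0, so only continuations after possible outcomes
  must succeed; the weights add up to 1.\<close>

lemma output_prob_round_one: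
  assumes "r < N" "\<forall>i<d r. \<forall>j<d r. gram (mset xs) i j = (if i = j then 1 else 0)"
    and "tensor_norm N d \<xi> = 1"
    and rec: "\<And>x. x \<in> set xs \<Longrightarrow> tensor_norm N (d(r := 1)) (apply_local N d r (row_mat (d r) x) \<xi>) \<noteq> 0 \<Longrightarrow>
      output_prob N (d(r := 1)) (Q x)
        (normalize_tensor N (d(r := 1)) (apply_local N d r (row_mat (d r) x) \<xi>)) v = 1"
  shows "output_prob N d (Round r 1 (map (\<lambda>x. (row_mat (d r) x, Q x)) xs)) \<xi> v = 1"
proof -
  let ?n = "\<lambda>x. tensor_norm N (d(r := 1)) (apply_local N d r (row_mat (d r) x) \<xi>)"
  let ?p = "\<lambda>x. output_prob N (d(r := 1)) (Q x)
        (normalize_tensor N (d(r := 1)) (apply_local N d r (row_mat (d r) x) \<xi>)) v"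
  have "(?n x)\<^sup>2 * ?p x = (?n x)\<^sup>2" if "x \<in> set xs" for x
  proof (cases "?n x = 0")
    case True
    show ?thesis by (simp only: True power_zero_numeral mult_zero_left)
  next
    case False
    show ?thesis by (simp only: rec[OF that False] mult_1_right)
  qed
  then have "map (\<lambda>x. (?n x)\<^sup>2 * ?p x) xs = map (\<lambda>x. (?n x)\<^sup>2) xs"
    by (rule map_cong[OF refl])
  then have "output_prob N d (Round r 1 (map (\<lambda>x. (row_mat (d r) x, Q x)) xs)) \<xi> v =
    (\<Sum>x\<leftarrow>xs. (tensor_norm N (d(r := 1)) (apply_local N d r (row_mat (d r) x) \<xi>))\<^sup>2)"
    by (simp only: output_prob.simps map_map o_def case_prod_conv)
  then show ?thesis using sum_norm_square_rows[of r N d xs \<xi>] assms(1-3) by simp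
qed

section \<open>The protocol, by induction on the number of parties still to measure\<close>

text \<open>The norm conditions are premises of the two conclusions because one of the two states may have
  probability 0 of reaching a node, where its normalization is the zero vector.\<close>

lemma ex_locc_measuring_first_parties:
  assumes "k \<le> N" "\<forall>i. k \<le> i \<and> i < N \<longrightarrow> d i = 1" "tensor_inner N d \<psi> \<phi> = 0"
  shows "\<exists>P. valid_locc N d P \<and> (tensor_norm N d \<psi> = 1 \<longrightarrow> output_prob N d P \<psi> Psi = 1) \<and>
    (tensor_norm N d \<phi> = 1 \<longrightarrow> output_prob N d P \<phi> Phi = 1)"
  using assms
proof (induction k arbitrary: d \<psi> \<phi>)
  case 0
  have "tensor_indices N d = (\<Pi>\<^sub>E r\<in>{..<N}. {0})"
    unfolding tensor_indices_def by (rule PiE_cong) (use 0 in auto)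
  then have "tensor_indices N d = {\<lambda>r\<in>{..<N}. 0}" by (simp add: PiE_singleton)
  then have inner: "tensor_inner N d \<xi> \<eta> = cnj (\<xi> (\<lambda>r\<in>{..<N}. 0)) * \<eta> (\<lambda>r\<in>{..<N}. 0)" for \<xi> \<eta>
    by (simp add: tensor_inner_def)
  show ?case
  \<comment> \<open>Only one coordinate is left, so one of the states is 0. It violates its norm
    premise, and announcing the other state is correct.\<close>
  proof (cases "\<phi> (\<lambda>r\<in>{..<N}. 0) = 0")
    case True
    then show ?thesis by (intro exI[of _ "Output Psi"]) (simp add: tensor_norm_def inner)
  next
    case False
    then have "\<psi> (\<lambda>r\<in>{..<N}. 0) = 0" using 0 inner by simp
    then show ?thesis by (intro exI[of _ "Output Phi"]) (simp add: tensor_norm_def inner)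
  qed
next
  case (Suc r)
  \<comment> \<open>Party \<open>r\<close> measures now; the parties after it are already
    collapsed.\<close>
  then have r: "r < N" by simp
  have "(\<Sum>i<d r. partial_inner N d r \<psi> \<phi> i i) = 0"
    using Suc.prems(3) tensor_inner_eq_partial_trace[OF r] by simp
  then obtain X where X: "\<forall>x\<in>#X. sesq (d r) (partial_inner N d r \<psi> \<phi>) x x = 0"
    "\<forall>i<d r. \<forall>j<d r. gram X i j = (if i = j then 1 else 0)"
    using ex_isotropic_frame by blast
  obtain xs where "mset xs = X"
    using ex_mset by blast
  with X have xs: "\<forall>x\<in>set xs. sesq (d r) (partial_inner N d r \<psi> \<phi>) x x = 0"
    "\<forall>i<d r. \<forall>j<d r. gram (mset xs) i j = (if i = j then 1 else 0)"
    by auto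
  let ?d = "d(r := 1)"
  let ?post = "\<lambda>x \<xi>. normalize_tensor N ?d (apply_local N d r (row_mat (d r) x) \<xi>)"
  have "\<exists>P. valid_locc N ?d P \<and>
      (tensor_norm N ?d (?post x \<psi>) = 1 \<longrightarrow> output_prob N ?d P (?post x \<psi>) Psi = 1) \<and>
      (tensor_norm N ?d (?post x \<phi>) = 1 \<longrightarrow> output_prob N ?d P (?post x \<phi>) Phi = 1)"
    if "x \<in> set xs" for x
  proof (rule Suc.IH)
    \<comment> \<open>Normalization keeps the inner product 0, even where a norm is 0, by the
      convention \<open>x / 0 = 0\<close>.\<close>
    show "tensor_inner N ?d (?post x \<psi>) (?post x \<phi>) = 0"
      unfolding tensor_inner_normalize tensor_inner_apply_row[OF r] using xs(1) that by simp
  qed (use Suc.prems(2) r in auto)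
  then obtain Q where "\<forall>x\<in>set xs. valid_locc N ?d (Q x) \<and>
      (tensor_norm N ?d (?post x \<psi>) = 1 \<longrightarrow> output_prob N ?d (Q x) (?post x \<psi>) Psi = 1) \<and>
      (tensor_norm N ?d (?post x \<phi>) = 1 \<longrightarrow> output_prob N ?d (Q x) (?post x \<phi>) Phi = 1)"
    by metis
  then have Q: "\<And>x. x \<in> set xs \<Longrightarrow> valid_locc N ?d (Q x)"
    "\<And>x. x \<in> set xs \<Longrightarrow> tensor_norm N ?d (?post x \<psi>) = 1 \<Longrightarrow>
       output_prob N ?d (Q x) (?post x \<psi>) Psi = 1"
    "\<And>x. x \<in> set xs \<Longrightarrow> tensor_norm N ?d (?post x \<phi>) = 1 \<Longrightarrow>
       output_prob N ?d (Q x) (?post x \<phi>) Phi = 1"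
    by blast+
  have "kraus_measurement (d r) 1 (map (row_mat (d r)) xs)"
    by (rule kraus_measurement_rows[OF xs(2)])
  then have "valid_locc N d (Round r 1 (map (\<lambda>x. (row_mat (d r) x, Q x)) xs))"
    using r Q by (auto simp: o_def)
  moreover have "output_prob N d (Round r 1 (map (\<lambda>x. (row_mat (d r) x, Q x)) xs)) \<psi> Psi = 1"
    if "tensor_norm N d \<psi> = 1"
  proof (rule output_prob_round_one[where Q = Q, OF r _ that])
    show "\<forall>i<d r. \<forall>j<d r. gram (mset xs) i j = (if i = j then 1 else 0)"
      by (rule xs(2))
    fix x
    assume "x \<in> set xs" "tensor_norm N ?d (apply_local N d r (row_mat (d r) x) \<psi>) \<noteq> 0"
    then show "output_prob N ?d (Q x) (?post x \<psi>) Psi = 1"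
      by (rule Q(2)[OF _ tensor_norm_normalize])
  qed
  moreover have "output_prob N d (Round r 1 (map (\<lambda>x. (row_mat (d r) x, Q x)) xs)) \<phi> Phi = 1"
    if "tensor_norm N d \<phi> = 1"
  proof (rule output_prob_round_one[where Q = Q, OF r _ that])
    show "\<forall>i<d r. \<forall>j<d r. gram (mset xs) i j = (if i = j then 1 else 0)"
      by (rule xs(2))
    fix x
    assume "x \<in> set xs" "tensor_norm N ?d (apply_local N d r (row_mat (d r) x) \<phi>) \<noteq> 0"
    then show "output_prob N ?d (Q x) (?post x \<phi>) Phi = 1"
      by (rule Q(3)[OF _ tensor_norm_normalize])
  qed
  ultimately show ?case by blast
qed

theorem mainTheorem1:
  fixes N :: nat and d :: "nat \<Rightarrow> nat" and \<psi> \<phi> :: tensor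
  assumes "N \<ge> 2"
    and "\<psi> \<in> tensor_space N d" and "\<phi> \<in> tensor_space N d"
    and "tensor_norm N d \<psi> = 1" and "tensor_norm N d \<phi> = 1"
    and "tensor_inner N d \<psi> \<phi> = 0"
  shows "\<exists>P :: verdict locc. valid_locc N d P \<and>
           output_prob N d P \<psi> Psi = 1 \<and> output_prob N d P \<phi> Phi = 1"
  using ex_locc_measuring_first_parties[of N N d \<psi> \<phi>] assms by auto

end
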